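(* Let $n\ge 2$, $v\in[0,1]$, and let $\Gamma=\Gamma_V$ for $V=(v,\dots,v)$, i.e. $\Gamma$ is the $n\times n$ matrix with $\gamma_{ii}=1-v$ for each $i\in[n]$ and $\gamma_{ij}=v$ for all $i\ne j$. Then for any $n$-player linear congestion game $\mathcal{G}$, the linear congestion game with altruistic social context $(\mathcal{G},\Gamma)$ satisfies $$\mathsf{PoS}(\mathcal{G},\Gamma)\le\frac{(\sqrt{3}+1)(1-v)}{\sqrt{3}-v(\sqrt{3}-1)}\quad\text{when } v\in[0,1/2],$$ $$\mathsf{PoS}(\mathcal{G},\Gamma)\le\frac{3-\sqrt{3}-2v(2-\sqrt{3})}{2(1-v)}\quad\text{when } v\in[1/2,1],$$ where for $v=1$ the last bound is understood as $+\infty$ (no constraint).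
   Context: Linear congestion game: a set of players $[n]=\{1,\dots,n\}$, $n\ge 2$, a finite set $E$ of resources, for each player $i$ a non-empty set $S_i\subseteq 2^E$ of strategies (each strategy is a non-empty subset of $E$), and for each $e\in E$ a latency function $\ell_e(x)=\alpha_e x+\beta_e$ with $\alpha_e,\beta_e\ge 0$. A strategy profile is $S=(s_1,\dots,s_n)$ with $s_i\in S_i$. The congestion of $e$ in $S$ is $n_e(S)=|\{j\in[n]:e\in s_j\}|$, and the cost of player $i$ in the underlying game is $c_i(S)=\sum_{e\in s_i}(\alpha_e n_e(S)+\beta_e)$. For $t\in S_i$, $S_{-i}\diamond t$ denotes the profile obtained from $S$ by replacing $s_i$ with $t$. A linear congestion game with altruistic social context is a pair $(\mathcal{G},\Gamma)$ where $\mathcal{G}$ is a linear congestion game with $n$ players and $\Gamma=(\gamma_{ij})\in\mathbb{R}^{n\times n}$ has non-negative entries; players and strategies are those of $\mathcal{G}$, but the cost of player $i$ in $S$ is $\widehat{c}_i(S)=\sum_{j\in[n]}\gamma_{ij}\,c_j(S)$. A pure Nash equilibrium of $(\mathcal{G},\Gamma)$ is a profile $S$ with $\widehat{c}_i(S)\le\widehat{c}_i(S_{-i}\diamond t)$ for every player $i$ and every $t\in S_i$. The social function is $\mathsf{SUM}(S)=\sum_{i\in[n]}c_i(S)$ (sum of the costs in the underlying game), and $S^*$ is a profile minimizing it. The price of stability $\mathsf{PoS}(\mathcal{G},\Gamma)$ is the minimum of $\mathsf{SUM}(S)/\mathsf{SUM}(S^* )$ over pure Nash equilibria $S$ of $(\mathcal{G},\Gamma)$;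 the bound $\mathsf{PoS}\le\rho$ means that there exists a pure Nash equilibrium $S$ with $\mathsf{SUM}(S)\le\rho\,\mathsf{SUM}(S^* )$. *)

theory Defs
  imports Complex_Main "HOL-Library.FuncSet" "HOL-Library.Extended_Real"
begin

record 'e congestion_game =
  num_players :: nat
  resources :: "'e set"
  strategies :: "nat \<Rightarrow> 'e set set"
  slope :: "'e \<Rightarrow> real"
  offset :: "'e \<Rightarrow> real"

definition players :: "'e congestion_game \<Rightarrow> nat set" where
  "players G = {1..num_players G}"

definition linear_congestion_game :: "'e congestion_game \<Rightarrow> bool" where
  "linear_congestion_game G \<longleftrightarrow>
     finite (resources G) \<and>
     (\<forall>i\<in>players G. strategies G i \<noteq> {} \<and>
        (\<forall>s\<in>strategies G i. s \<noteq> {} \<and> s \<subseteq> resources G)) \<and>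
     (\<forall>e\<in>resources G. 0 \<le> slope G e \<and> 0 \<le> offset G e)"

definition latency :: "'e congestion_game \<Rightarrow> 'e \<Rightarrow> real \<Rightarrow> real" where
  "latency G e x = slope G e * x + offset G e"

definition profiles :: "'e congestion_game \<Rightarrow> (nat \<Rightarrow> 'e set) set" where
  "profiles G = (\<Pi>\<^sub>E i\<in>players G. strategies G i)"

definition congestion :: "'e congestion_game \<Rightarrow> (nat \<Rightarrow> 'e set) \<Rightarrow> 'e \<Rightarrow> nat" where
  "congestion G S e = card {j \<in> players G. e \<in> S j}"

definition cost :: "'e congestion_game \<Rightarrow> (nat \<Rightarrow> 'e set) \<Rightarrow> nat \<Rightarrow> real" where
  "cost G S i = (\<Sum>e\<in>S i. latency G e (real (congestion G S e)))"

definition altruistic_cost ::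
    "'e congestion_game \<Rightarrow> (nat \<Rightarrow> nat \<Rightarrow> real) \<Rightarrow> (nat \<Rightarrow> 'e set) \<Rightarrow> nat \<Rightarrow> real" where
  "altruistic_cost G \<Gamma> S i = (\<Sum>j\<in>players G. \<Gamma> i j * cost G S j)"

definition pure_nash ::
    "'e congestion_game \<Rightarrow> (nat \<Rightarrow> nat \<Rightarrow> real) \<Rightarrow> (nat \<Rightarrow> 'e set) \<Rightarrow> bool" where
  "pure_nash G \<Gamma> S \<longleftrightarrow> S \<in> profiles G \<and>
     (\<forall>i\<in>players G. \<forall>t\<in>strategies G i.
        altruistic_cost G \<Gamma> S i \<le> altruistic_cost G \<Gamma> (S(i := t)) i)"

definition social_cost :: "'e congestion_game \<Rightarrow> (nat \<Rightarrow> 'e set) \<Rightarrow> real" where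
  "social_cost G S = (\<Sum>i\<in>players G. cost G S i)"

definition social_optimum :: "'e congestion_game \<Rightarrow> (nat \<Rightarrow> 'e set) \<Rightarrow> bool" where
  "social_optimum G S \<longleftrightarrow> S \<in> profiles G \<and>
     (\<forall>T\<in>profiles G. social_cost G S \<le> social_cost G T)"

text \<open>
  The price of stability is at most \<open>\<rho>\<close>. The bound is in product form, so that it makes sense
  when the optimal social cost is 0. The case \<open>\<rho> = \<infinity>\<close>, in which only the existence of a
  pure Nash equilibrium is demanded, is separate because \<open>\<infinity> * 0 = 0\<close> in type \<open>ereal\<close>.
  All social optima have the same social cost, so the choice of \<open>T\<close> is irrelevant.
\<close>

definition PoS_le :: "'e congestion_game \<Rightarrow> (nat \<Rightarrow> nat \<Rightarrow> real) \<Rightarrow> ereal \<Rightarrow> bool" where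
  "PoS_le G \<Gamma> \<rho> \<longleftrightarrow> (\<exists>S T. pure_nash G \<Gamma> S \<and> social_optimum G T \<and>
     (\<rho> = \<infinity> \<or> ereal (social_cost G S) \<le> \<rho> * ereal (social_cost G T)))"

definition uniform_context :: "real \<Rightarrow> nat \<Rightarrow> nat \<Rightarrow> real" where
  "uniform_context v i j = (if i = j then 1 - v else v)"

end

theory Submission imports Defs begin

text \<open>
  The altruistic cost of player \<open>i\<close> is \<open>(1 - 2 * v) * cost i + v * SUM\<close>. Hence combining
  Rosenthal's potential and the social cost in the same proportions gives an exact potential, and
  a minimizer \<open>S\<close> of it is a pure Nash equilibrium. Adding \<open>2 * a\<close> times the inequality between
  the potentials of \<open>S\<close> and an optimum \<open>T\<close>, and \<open>b\<close> times the sum of the Nash inequalities for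
  the deviations to \<open>T\<close>, reduces the bound to a quadratic inequality in the two congestions of a
  single resource. For suitable \<open>a\<close> and \<open>b\<close> the quadratic form is degenerate, and \<open>v\<close> enters
  only as a common factor.
\<close>

section \<open>Congestions, profiles and costs as sums over resources\<close>

lemma finite_players: "finite (players G)"
  by (simp add: players_def)

text \<open>Counting by indicators lets an exchange of sums turn sums over players into sums over
  resources, where each player's indicator adds up to the congestion.\<close>

lemma congestion_eq_sum:
  "real (congestion G S e) = (\<Sum>j\<in>players G. of_bool (e \<in> S j))"
  using finite_players[of G] by (simp add: congestion_def Int_def sum.If_cases)

lemma congestion_fun_upd:
  assumes "i \<in> players G"
  shows "real (congestion G (S(i := t)) e) =
    real (congestion G S e) - of_bool (e \<in> S i) + of_bool (e \<in> t)"
proof -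
  have "(\<Sum>j\<in>players G - {i}. of_bool (e \<in> (S(i := t)) j)) =
      (\<Sum>j\<in>players G - {i}. of_bool (e \<in> S j) :: real)"
    by (intro sum.cong) auto
  then show ?thesis
    unfolding congestion_eq_sum sum.remove[OF finite_players assms] by simp
qed

lemma profile_subset_resources:
  assumes "linear_congestion_game G" "S \<in> profiles G" "i \<in> players G"
  shows "S i \<subseteq> resources G"
  using assms unfolding linear_congestion_game_def profiles_def by (meson PiE_mem)

lemma finite_profiles:
  assumes "linear_congestion_game G"
  shows "finite (profiles G)"
proof -
  have "finite (strategies G i)" if "i \<in> players G" for i
  proof (rule finite_subset)
    show "strategies G i \<subseteq> Pow (resources G)"
      using assms that by (auto simp: linear_congestion_game_def)
  qed (use assms in \<open>simp add: linear_congestion_game_def\<close>)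
  then show ?thesis
    unfolding profiles_def by (intro finite_PiE finite_players)
qed

lemma profiles_nonempty:
  assumes "linear_congestion_game G"
  shows "profiles G \<noteq> {}"
  using assms by (simp add: profiles_def linear_congestion_game_def PiE_eq_empty_iff)

lemma profiles_fun_upd:
  assumes "S \<in> profiles G" "i \<in> players G" "t \<in> strategies G i"
  shows "S(i := t) \<in> profiles G"
  using assms unfolding profiles_def by (auto simp: PiE_iff extensional_def)

text \<open>The index set no longer depends on the profile, so the costs of different profiles can
  be subtracted term by term.\<close>

lemma cost_eq_sum_resources:
  assumes "linear_congestion_game G" "S \<in> profiles G" "i \<in> players G"
  shows "cost G S i = (\<Sum>e\<in>resources G. of_bool (e \<in> S i) * latency G e (congestion G S e))"
proof -
  have "S i \<subseteq> resources G" "finite (resources G)"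
    using profile_subset_resources[OF assms] assms(1) by (auto simp: linear_congestion_game_def)
  then show ?thesis
    unfolding cost_def by (intro sum.mono_neutral_cong_left) auto
qed

lemma social_cost_eq_sum_resources:
  assumes "linear_congestion_game G" "S \<in> profiles G"
  shows "social_cost G S =
    (\<Sum>e\<in>resources G. congestion G S e * latency G e (congestion G S e))"
proof -
  have "social_cost G S =
      (\<Sum>i\<in>players G. \<Sum>e\<in>resources G. of_bool (e \<in> S i) * latency G e (congestion G S e))"
    unfolding social_cost_def using assms by (intro sum.cong) (auto simp: cost_eq_sum_resources)
  also have "\<dots> =
      (\<Sum>e\<in>resources G. \<Sum>i\<in>players G. of_bool (e \<in> S i) * latency G e (congestion G S e))"
    by (rule sum.swap)
  also have "\<dots> = (\<Sum>e\<in>resources G. congestion G S e * latency G e (congestion G S e))"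
    by (simp only: congestion_eq_sum sum_distrib_right)
  finally show ?thesis .
qed

section \<open>An exact potential and the existence of equilibria\<close>

text \<open>This is \<open>(1 - 2 * v)\<close> times Rosenthal's potential plus \<open>v\<close> times the social cost.\<close>

definition resource_potential :: "'e congestion_game \<Rightarrow> real \<Rightarrow> 'e \<Rightarrow> real \<Rightarrow> real" where
  "resource_potential G v e x =
     slope G e * (x\<^sup>2 + (1 - 2 * v) * x) / 2 + (1 - v) * offset G e * x"

definition potential :: "'e congestion_game \<Rightarrow> real \<Rightarrow> (nat \<Rightarrow> 'e set) \<Rightarrow> real" where
  "potential G v S = (\<Sum>e\<in>resources G. resource_potential G v e (congestion G S e))"

lemma altruistic_cost_uniform:
  assumes "i \<in> players G"
  shows "altruistic_cost G (uniform_context v) S i =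
    (1 - 2 * v) * cost G S i + v * social_cost G S"
proof -
  have "altruistic_cost G (uniform_context v) S i =
      (1 - v) * cost G S i + (\<Sum>j\<in>players G - {i}. v * cost G S j)"
    unfolding altruistic_cost_def sum.remove[OF finite_players assms]
    by (auto simp: uniform_context_def intro!: sum.cong)
  moreover have "social_cost G S = cost G S i + (\<Sum>j\<in>players G - {i}. cost G S j)"
    unfolding social_cost_def by (rule sum.remove[OF finite_players assms])
  ultimately show ?thesis
    by (simp add: sum_distrib_left algebra_simps)
qed

lemma exact_potential:
  assumes "linear_congestion_game G" "S \<in> profiles G" "i \<in> players G" "t \<in> strategies G i"
  shows "altruistic_cost G (uniform_context v) (S(i := t)) i
      - altruistic_cost G (uniform_context v) S i =
    potential G v (S(i := t)) - potential G v S"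
proof -
  let ?S' = "S(i := t)"
  let ?c = "\<lambda>S e. (1 - 2 * v) * (of_bool (e \<in> S i) * latency G e (congestion G S e))
      + v * (congestion G S e * latency G e (congestion G S e))"
  have S': "?S' \<in> profiles G"
    using assms by (simp add: profiles_fun_upd)
  have ac: "altruistic_cost G (uniform_context v) R i = (\<Sum>e\<in>resources G. ?c R e)"
    if "R \<in> profiles G" for R
    using assms that
    by (simp add: altruistic_cost_uniform cost_eq_sum_resources social_cost_eq_sum_resources
        sum_distrib_left sum.distrib)
  \<comment> \<open>The identity holds already at each resource: a departure from congestion x
    lowers both sides by \<open>slope G e * (x - v) + (1 - v) * offset G e\<close>, and an arrival
    raises both by the same expression with x + 1 for x.\<close>
  have "?c ?S' e - ?c S e = resource_potential G v e (congestion G ?S' e)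
      - resource_potential G v e (congestion G S e)" for e
    unfolding congestion_fun_upd[OF assms(3)] resource_potential_def latency_def
    by (cases "e \<in> S i"; cases "e \<in> t") (simp_all add: field_simps power2_eq_square)
  then show ?thesis
    unfolding ac[OF assms(2)] ac[OF S'] potential_def sum_subtractf[symmetric] by simp
qed

lemma ex_potential_minimizer:
  assumes "linear_congestion_game G"
  obtains S where "S \<in> profiles G" "\<And>R. R \<in> profiles G \<Longrightarrow> potential G v S \<le> potential G v R"
  using ex_is_arg_min_if_finite[OF finite_profiles[OF assms] profiles_nonempty[OF assms],
      of "potential G v"]
  by (auto simp: is_arg_min_linorder)

lemma ex_social_optimum:
  assumes "linear_congestion_game G"
  obtains T where "social_optimum G T"
  using ex_is_arg_min_if_finite[OF finite_profiles[OF assms] profiles_nonempty[OF assms],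
      of "social_cost G"]
  by (auto simp: is_arg_min_linorder social_optimum_def)

lemma potential_minimizer_pure_nash:
  assumes "linear_congestion_game G" "S \<in> profiles G"
    and "\<And>R. R \<in> profiles G \<Longrightarrow> potential G v S \<le> potential G v R"
  shows "pure_nash G (uniform_context v) S"
  unfolding pure_nash_def
proof (intro conjI ballI)
  fix i t assume "i \<in> players G" "t \<in> strategies G i"
  with exact_potential[OF assms(1,2) this, of v] assms(3)[OF profiles_fun_upd[OF assms(2) this]]
  show "altruistic_cost G (uniform_context v) S i
      \<le> altruistic_cost G (uniform_context v) (S(i := t)) i"
    by linarith
qed (fact assms(2))

section \<open>Inequalities at a potential minimizer and a criterion per resource\<close>

text \<open>
  Player \<open>i\<close> alone moves from \<open>S i\<close> to \<open>T i\<close>, and the changes of potential are summed over \<open>i\<close>.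
  The change at a resource in both \<open>S i\<close> and \<open>T i\<close> is 0, which is at most the join term minus the
  leave term because these differ by the slope.
\<close>

lemma sum_deviations_nonneg:
  fixes v :: real
  assumes "linear_congestion_game G" "S \<in> profiles G" "T \<in> profiles G"
    and "\<And>R. R \<in> profiles G \<Longrightarrow> potential G v S \<le> potential G v R"
  shows "0 \<le> (\<Sum>e\<in>resources G.
      congestion G T e * (slope G e * (real (congestion G S e) + 1 - v) + (1 - v) * offset G e)
      - congestion G S e * (slope G e * (real (congestion G S e) - v) + (1 - v) * offset G e))"
proof -
  let ?join = "\<lambda>e. slope G e * (real (congestion G S e) + 1 - v) + (1 - v) * offset G e"
  let ?leave = "\<lambda>e. slope G e * (real (congestion G S e) - v) + (1 - v) * offset G e"
  have "0 \<le> (\<Sum>e\<in>resources G. of_bool (e \<in> T i) * ?join e - of_bool (e \<in> S i) * ?leave e)"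
    if i: "i \<in> players G" for i
  proof -
    let ?S' = "S(i := T i)"
    have "T i \<in> strategies G i"
      using assms(3) i by (auto simp: profiles_def)
    then have "0 \<le> potential G v ?S' - potential G v S"
      using assms(2,4) i by (simp add: profiles_fun_upd)
    also have "\<dots> \<le>
        (\<Sum>e\<in>resources G. of_bool (e \<in> T i) * ?join e - of_bool (e \<in> S i) * ?leave e)"
      unfolding potential_def sum_subtractf[symmetric]
    proof (rule sum_mono)
      fix e assume "e \<in> resources G"
      then have "0 \<le> slope G e"
        using assms(1) by (simp add: linear_congestion_game_def)
      then show "resource_potential G v e (congestion G ?S' e)
          - resource_potential G v e (congestion G S e)
          \<le> of_bool (e \<in> T i) * ?join e - of_bool (e \<in> S i) * ?leave e"
        unfolding congestion_fun_upd[OF i] resource_potential_def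
        by (cases "e \<in> S i"; cases "e \<in> T i") (simp_all add: field_simps power2_eq_square)
    qed
    finally show ?thesis .
  qed
  then have "0 \<le> (\<Sum>i\<in>players G. \<Sum>e\<in>resources G.
      of_bool (e \<in> T i) * ?join e - of_bool (e \<in> S i) * ?leave e)"
    by (rule sum_nonneg)
  also have "\<dots> = (\<Sum>e\<in>resources G. \<Sum>i\<in>players G.
      of_bool (e \<in> T i) * ?join e - of_bool (e \<in> S i) * ?leave e)"
    by (rule sum.swap)
  also have "\<dots> = (\<Sum>e\<in>resources G. congestion G T e * ?join e - congestion G S e * ?leave e)"
    by (simp only: sum_subtractf sum_distrib_right[symmetric] congestion_eq_sum[symmetric])
  finally show ?thesis .
qed

text \<open>The numbers \<open>a\<close> and \<open>b\<close> are multipliers in a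
  linear-programming style certificate. In \<open>slope\<close>, the bracket after \<open>a\<close>
  is twice the potential difference and the bracket after \<open>b\<close> is minus the deviation
  term, both per unit of slope. Constant latencies contribute
  \<open>(2 * a + b) * (1 - v) * (x - y)\<close>, which dominates \<open>x - \<rho> * y\<close> by
  the two \<open>offset\<close> conditions.\<close>

lemma PoS_le_if_resourcewise:
  fixes a b v \<rho> :: real
  assumes G: "linear_congestion_game G"
    and ab: "0 \<le> a" "0 \<le> b"
    and offset: "1 \<le> (2 * a + b) * (1 - v)" "(2 * a + b) * (1 - v) \<le> \<rho>"
    and slope: "\<And>m k. let x = real m; y = real k in
      x\<^sup>2 - \<rho> * y\<^sup>2 \<le> a * (x\<^sup>2 - y\<^sup>2 + (1 - 2 * v) * (x - y)) +
        b * (x\<^sup>2 - x * y - v * x - (1 - v) * y)"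
  shows "PoS_le G (uniform_context v) (ereal \<rho>)"
proof -
  obtain S where S: "S \<in> profiles G" "\<And>R. R \<in> profiles G \<Longrightarrow> potential G v S \<le> potential G v R"
    using ex_potential_minimizer[OF G] by blast
  obtain T where opt: "social_optimum G T"
    using ex_social_optimum[OF G] by blast
  then have T: "T \<in> profiles G"
    by (simp add: social_optimum_def)
  define dev where "dev = (\<lambda>e.
      congestion G T e * (slope G e * (real (congestion G S e) + 1 - v) + (1 - v) * offset G e)
      - congestion G S e * (slope G e * (real (congestion G S e) - v) + (1 - v) * offset G e))"
  have "social_cost G S - \<rho> * social_cost G T =
      (\<Sum>e\<in>resources G. congestion G S e * latency G e (congestion G S e)
        - \<rho> * (congestion G T e * latency G e (congestion G T e)))"
    by (simp add: social_cost_eq_sum_resources G S(1) T sum_subtractf sum_distrib_left)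
  also have "\<dots> \<le> (\<Sum>e\<in>resources G.
      2 * a * (resource_potential G v e (congestion G S e)
        - resource_potential G v e (congestion G T e)) - b * dev e)"
  proof (rule sum_mono)
    fix e assume e: "e \<in> resources G"
    define x y where "x = real (congestion G S e)" and "y = real (congestion G T e)"
    define c where "c = (2 * a + b) * (1 - v)"
    have "slope G e * (x\<^sup>2 - \<rho> * y\<^sup>2) \<le> slope G e *
        (a * (x\<^sup>2 - y\<^sup>2 + (1 - 2 * v) * (x - y)) + b * (x\<^sup>2 - x * y - v * x - (1 - v) * y))"
      using slope[of "congestion G S e" "congestion G T e"] e G
      by (intro mult_left_mono) (simp_all add: x_def y_def Let_def linear_congestion_game_def)
    moreover have "offset G e * (x - \<rho> * y) \<le> offset G e * (c * (x - y))"
    proof (rule mult_left_mono)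
      have "1 * x \<le> c * x" "c * y \<le> \<rho> * y"
        using offset by (intro mult_right_mono; simp add: x_def y_def c_def)+
      then show "x - \<rho> * y \<le> c * (x - y)"
        by (simp add: algebra_simps)
    qed (use e G in \<open>simp add: linear_congestion_game_def\<close>)
    ultimately show "congestion G S e * latency G e (congestion G S e)
        - \<rho> * (congestion G T e * latency G e (congestion G T e))
        \<le> 2 * a * (resource_potential G v e (congestion G S e)
          - resource_potential G v e (congestion G T e)) - b * dev e"
      unfolding dev_def latency_def resource_potential_def c_def
        x_def[symmetric] y_def[symmetric]
      by (simp add: field_simps power2_eq_square)
  qed
  also have "\<dots> = 2 * a * (potential G v S - potential G v T) - b * (\<Sum>e\<in>resources G. dev e)"
    by (simp add: potential_def sum_subtractf sum_distrib_left right_diff_distrib)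
  also have "\<dots> \<le> 0"
  proof -
    have "0 \<le> (\<Sum>e\<in>resources G. dev e)"
      unfolding dev_def by (rule sum_deviations_nonneg[OF G S(1) T S(2)])
    then have "0 \<le> b * (\<Sum>e\<in>resources G. dev e)"
      using ab by simp
    moreover have "2 * a * (potential G v S - potential G v T) \<le> 0"
      using ab S(2)[OF T] by (simp add: mult_nonneg_nonpos)
    ultimately show ?thesis
      by linarith
  qed
  finally have "social_cost G S \<le> \<rho> * social_cost G T"
    by simp
  then show ?thesis
    unfolding PoS_le_def using potential_minimizer_pure_nash[OF G S] opt by auto
qed

section \<open>Two quadratic inequalities over the natural numbers\<close>

text \<open>Since (2 - sqrt 3) * (2 + sqrt 3) = 1, the quadratic part is a multiple of a square, and
  completing the square in x leaves a remainder linear in y. Integrality is essential: for y = 1 the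
  form is a positive multiple of x * (x - 1), negative for 0 < x < 1.\<close>

lemma nat_quadratic_nonneg_le_half:
  fixes m k :: nat
  defines "x \<equiv> real m" and "y \<equiv> real k"
  shows "0 \<le> (2 - sqrt 3) * x\<^sup>2 - 2 * x * y + (2 + sqrt 3) * y\<^sup>2
    + sqrt 3 * x - (2 + sqrt 3) * y" (is "0 \<le> ?Q")
proof -
  define r where "r = sqrt (3::real)"
  have r: "r\<^sup>2 = 3" "1 \<le> r" "r < 2"
    by (simp_all add: r_def real_less_lsqrt)
  have Q: "?Q = (2 - r) * x\<^sup>2 - 2 * x * y + (2 + r) * y\<^sup>2 + r * x - (2 + r) * y"
    by (simp add: r_def)
  consider "k = 0" | "k = 1" | "2 \<le> k" by linarith
  then show ?thesis
  proof cases
    case 1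
    then have "?Q = (2 - r) * x\<^sup>2 + r * x"
      unfolding Q by (simp add: y_def)
    with r show ?thesis by (simp add: x_def)
  next
    case 2
    then have "?Q = (2 - r) * (x * (x - 1))"
      unfolding Q by (simp add: y_def algebra_simps power2_eq_square)
    moreover have "0 \<le> x * (x - 1)"
      by (cases m) (simp_all add: x_def)
    ultimately show ?thesis using r by simp
  next
    case 3
    \<comment> \<open>The last summand vanishes because \<open>r\<^sup>2 = 3\<close>; with it the
      equation is a polynomial identity in \<open>r\<close>. The remainder 4 * (r - 1) * y - 3 is
      slightly negative at y = 1, hence the separate case.\<close>
    have "4 * (2 - r) * ?Q = (2 * (2 - r) * x + r - 2 * y)\<^sup>2 + (4 * (r - 1) * y - 3)
        + (3 - r\<^sup>2) * (4 * (y\<^sup>2 - y) + 1)"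
      unfolding Q by (simp add: algebra_simps power2_eq_square)
    moreover have "5 / 3 \<le> r"
      unfolding r_def by (rule real_le_rsqrt) (simp add: power2_eq_square)
    then have "2 / 3 * 2 \<le> (r - 1) * y"
      using 3 by (intro mult_mono) (simp_all add: y_def)
    then have "0 \<le> 4 * (r - 1) * y - 3"
      by linarith
    ultimately have "0 \<le> (4 * (2 - r)) * ?Q"
      by (simp add: r(1))
    then show ?thesis
      using r(3) by (simp only: zero_le_mult_iff) auto
  qed
qed

text \<open>The roles of x and y are exchanged. Now (sqrt 3 + 1) * (3 * sqrt 3 - 5) = (sqrt 3 - 1)^2
  makes the quadratic part degenerate, the square is completed in y, and the remainder is linear in
  x and just negative at x = 1.\<close>

lemma nat_quadratic_nonneg_ge_half:
  fixes m k :: nat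
  defines "x \<equiv> real m" and "y \<equiv> real k"
  shows "0 \<le> (sqrt 3 + 1) * x\<^sup>2 - 2 * (sqrt 3 - 1) * x * y + (3 * sqrt 3 - 5) * y\<^sup>2
    - (sqrt 3 + 1) * x + (3 - sqrt 3) * y" (is "0 \<le> ?Q")
proof -
  define r where "r = sqrt (3::real)"
  have r: "r\<^sup>2 = 3" "r < 2"
    by (simp_all add: r_def real_less_lsqrt)
  \<comment> \<open>The bound has to exceed 5/3, where 3 * r - 5 changes sign, and to reach 46/27,
    which makes the remainder nonnegative at x = 2.\<close>
  have r_lower: "173 / 100 \<le> r"
    unfolding r_def by (rule real_le_rsqrt) (simp add: power2_eq_square)
  have Q: "?Q = (r + 1) * x\<^sup>2 - 2 * (r - 1) * x * y + (3 * r - 5) * y\<^sup>2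
      - (r + 1) * x + (3 - r) * y"
    by (simp add: r_def)
  consider "m = 0" | "m = 1" | "2 \<le> m" by linarith
  then show ?thesis
  proof cases
    case 1
    then have "?Q = (3 * r - 5) * y\<^sup>2 + (3 - r) * y"
      unfolding Q by (simp add: x_def)
    with r r_lower show ?thesis by (simp add: y_def)
  next
    case 2
    then have "?Q = (3 * r - 5) * (y * (y - 1))"
      unfolding Q by (simp add: x_def algebra_simps power2_eq_square)
    moreover have "0 \<le> y * (y - 1)"
      by (cases k) (simp_all add: y_def)
    ultimately show ?thesis using r_lower by simp
  next
    case 3
    have "4 * (3 * r - 5) * ?Q = (2 * (3 * r - 5) * y + (3 - r) - 2 * (r - 1) * x)\<^sup>2
        + ((24 * r - 40) * x - (12 - 6 * r)) + (r\<^sup>2 - 3) * (8 * x\<^sup>2 - 16 * x - 1)"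
      unfolding Q by (simp add: algebra_simps power2_eq_square)
    moreover have "(24 * r - 40) * 2 \<le> (24 * r - 40) * x"
      using 3 r_lower by (intro mult_left_mono) (simp_all add: x_def)
    then have "0 \<le> (24 * r - 40) * x - (12 - 6 * r)"
      using r_lower by (simp add: left_diff_distrib)
    ultimately have "0 \<le> (4 * (3 * r - 5)) * ?Q"
      by (simp add: r(1))
    then show ?thesis
      using r_lower by (simp only: zero_le_mult_iff) auto
  qed
qed

section \<open>Choice of the multipliers in the two ranges of v\<close>

lemma PoS_le_if_le_half:
  assumes "linear_congestion_game G" "0 \<le> v" "v \<le> 1/2"
  shows "PoS_le G (uniform_context v)
    (ereal (((sqrt 3 + 1) * (1 - v)) / (sqrt 3 - v * (sqrt 3 - 1))))"
proof -
  define r where "r = sqrt (3::real)"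
  define d where "d = 1 / (r - v * (r - 1))"
  \<comment> \<open>The values come from making the slope inequality tight at (x, y) = (1, 1) and
    (0, 1), that is \<open>\<rho> = 1 + b\<close> and \<open>(2 * a + b) * (1 - v) = \<rho>\<close>,
    together with the degeneracy of its quadratic part.\<close>
  define a b \<rho> where "a = (r + 2 * v) * d / 2" and "b = (1 - 2 * v) * d"
    and "\<rho> = (r + 1) * (1 - v) * d"
  have r: "1 \<le> r"
    by (simp add: r_def)
  have "v * (r - 1) \<le> 1 * (r - 1)"
    using assms r by (intro mult_right_mono) auto
  then have D: "0 < r - v * (r - 1)"
    by simp
  then have d: "d * (r - v * (r - 1)) = 1" "0 \<le> d"
    by (simp_all add: d_def)
  have "PoS_le G (uniform_context v) (ereal \<rho>)"
  proof (rule PoS_le_if_resourcewise)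
    show "0 \<le> a" "0 \<le> b"
      using assms r d by (simp_all add: a_def b_def)
    have \<rho>: "(2 * a + b) * (1 - v) = \<rho>"
      by (simp add: a_def b_def \<rho>_def field_simps)
    have "\<rho> = 1 + b"
      unfolding \<rho>_def b_def using d(1) by algebra
    with \<rho> \<open>0 \<le> b\<close> show "1 \<le> (2 * a + b) * (1 - v)" "(2 * a + b) * (1 - v) \<le> \<rho>"
      by simp_all
    fix m k :: nat
    define x y where "x = real m" and "y = real k"
    define lhs rhs where "lhs = x\<^sup>2 - \<rho> * y\<^sup>2"
      and "rhs = a * (x\<^sup>2 - y\<^sup>2 + (1 - 2 * v) * (x - y)) + b * (x\<^sup>2 - x * y - v * x - (1 - v) * y)"
    have a2: "2 * a = (r + 2 * v) * d"
      by (simp add: a_def)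
    have "2 * (a + b - 1) = b * (2 - r)" "2 * (\<rho> - a) = b * (2 + r)"
      "2 * (a * (1 - 2 * v) - b * v) = b * r" "2 * (a * (1 - 2 * v) + b * (1 - v)) = b * (2 + r)"
      using a2 d(1) unfolding b_def \<rho>_def by algebra+
    moreover have "2 * (rhs - lhs) = 2 * (a + b - 1) * x\<^sup>2 - b * 2 * x * y + 2 * (\<rho> - a) * y\<^sup>2
        + 2 * (a * (1 - 2 * v) - b * v) * x - 2 * (a * (1 - 2 * v) + b * (1 - v)) * y"
      by (simp add: lhs_def rhs_def algebra_simps power2_eq_square)
    ultimately have "2 * (rhs - lhs) =
        b * ((2 - r) * x\<^sup>2 - 2 * x * y + (2 + r) * y\<^sup>2 + r * x - (2 + r) * y)"
      by (simp only:) (simp add: algebra_simps)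
    also have "0 \<le> \<dots>"
      using nat_quadratic_nonneg_le_half[of m k] \<open>0 \<le> b\<close>
      by (intro mult_nonneg_nonneg) (simp_all add: x_def y_def r_def)
    finally have "lhs \<le> rhs"
      by simp
    then show "let x = real m; y = real k in
        x\<^sup>2 - \<rho> * y\<^sup>2 \<le> a * (x\<^sup>2 - y\<^sup>2 + (1 - 2 * v) * (x - y)) +
          b * (x\<^sup>2 - x * y - v * x - (1 - v) * y)"
      by (simp only: Let_def lhs_def rhs_def x_def y_def)
  qed (fact assms(1))
  then show ?thesis
    by (simp add: \<rho>_def d_def r_def)
qed

lemma PoS_le_if_ge_half:
  assumes "linear_congestion_game G" "1/2 \<le> v" "v < 1"
  shows "PoS_le G (uniform_context v)
    (ereal ((3 - sqrt 3 - 2 * v * (2 - sqrt 3)) / (2 * (1 - v))))"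
proof -
  define r where "r = sqrt (3::real)"
  define d where "d = 1 / (2 * (1 - v))"
  \<comment> \<open>Here the tight points are (1, 1) and (1, 0), that is
    \<open>\<rho> = 1 + b\<close> and \<open>(2 * a + b) * (1 - v) = 1\<close>, again with a
    degenerate quadratic part. So the lower \<open>offset\<close> condition is the sharp one,
    instead of the upper.\<close>
  define a b \<rho> where "a = (2 - (r - 1) * (2 * v - 1)) * d / 2"
    and "b = (r - 1) * (2 * v - 1) * d" and "\<rho> = (3 - r - 2 * v * (2 - r)) * d"
  have r: "1 \<le> r" "r < 2"
    by (simp_all add: r_def real_less_lsqrt)
  have d: "d * (2 * (1 - v)) = 1" "0 \<le> d"
    using assms by (simp_all add: d_def)
  have "PoS_le G (uniform_context v) (ereal \<rho>)"
  proof (rule PoS_le_if_resourcewise)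
    have "(r - 1) * (2 * v - 1) \<le> 1 * 1"
      using assms r by (intro mult_mono) auto
    then show "0 \<le> a"
      using d by (simp add: a_def)
    show "0 \<le> b"
      using assms r d by (simp add: b_def)
    have a2: "2 * a = (2 - (r - 1) * (2 * v - 1)) * d"
      by (simp add: a_def)
    have \<rho>: "(2 * a + b) * (1 - v) = 1" "\<rho> = 1 + b"
      using a2 d(1) unfolding b_def \<rho>_def by algebra+
    with \<open>0 \<le> b\<close> show "1 \<le> (2 * a + b) * (1 - v)" "(2 * a + b) * (1 - v) \<le> \<rho>"
      by simp_all
    fix m k :: nat
    define x y where "x = real m" and "y = real k"
    define lhs rhs where "lhs = x\<^sup>2 - \<rho> * y\<^sup>2"
      and "rhs = a * (x\<^sup>2 - y\<^sup>2 + (1 - 2 * v) * (x - y)) + b * (x\<^sup>2 - x * y - v * x - (1 - v) * y)"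
    \<comment> \<open>This is the common factor carrying all dependence on \<open>v\<close>; it is
      nonnegative exactly because \<open>v\<close> is at least 1/2.\<close>
    define c where "c = (2 * v - 1) * d"
    have "2 * (a + b - 1) = c * (r + 1)"
      using a2 d(1) unfolding b_def c_def by algebra
    moreover have "2 * b = c * (2 * (r - 1))" "2 * (\<rho> - a) = c * (3 * r - 5)"
      "2 * (b * v - a * (1 - 2 * v)) = c * (r + 1)"
      "- (2 * (a * (1 - 2 * v) + b * (1 - v))) = c * (3 - r)"
      by (simp_all add: a_def b_def \<rho>_def c_def field_simps)
    moreover have "2 * (rhs - lhs) = 2 * (a + b - 1) * x\<^sup>2 - 2 * b * x * y + 2 * (\<rho> - a) * y\<^sup>2
        - 2 * (b * v - a * (1 - 2 * v)) * x + - (2 * (a * (1 - 2 * v) + b * (1 - v))) * y"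
      by (simp add: lhs_def rhs_def algebra_simps power2_eq_square)
    ultimately have "2 * (rhs - lhs) = c * ((r + 1) * x\<^sup>2 - 2 * (r - 1) * x * y
        + (3 * r - 5) * y\<^sup>2 - (r + 1) * x + (3 - r) * y)"
      by (simp only:) (simp add: algebra_simps)
    also have "0 \<le> \<dots>"
      using nat_quadratic_nonneg_ge_half[of m k] assms d
      by (intro mult_nonneg_nonneg) (simp_all add: x_def y_def r_def c_def)
    finally have "lhs \<le> rhs"
      by simp
    then show "let x = real m; y = real k in
        x\<^sup>2 - \<rho> * y\<^sup>2 \<le> a * (x\<^sup>2 - y\<^sup>2 + (1 - 2 * v) * (x - y)) +
          b * (x\<^sup>2 - x * y - v * x - (1 - v) * y)"
      by (simp only: Let_def lhs_def rhs_def x_def y_def)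
  qed (fact assms(1))
  then show ?thesis
    by (simp add: \<rho>_def d_def r_def)
qed

text \<open>Serves v = 1, where the denominator of the finite bound vanishes; finiteness of the set
  of profiles still yields an equilibrium and an optimum.\<close>

lemma PoS_le_infinity:
  assumes "linear_congestion_game G"
  shows "PoS_le G (uniform_context v) \<infinity>"
proof -
  obtain S where "S \<in> profiles G" "\<And>R. R \<in> profiles G \<Longrightarrow> potential G v S \<le> potential G v R"
    using ex_potential_minimizer[OF assms] by blast
  from potential_minimizer_pure_nash[OF assms this] ex_social_optimum[OF assms]
  show ?thesis
    unfolding PoS_le_def by blast
qed

theorem theorem9:
  fixes G :: "'e congestion_game" and n :: nat and v :: real
  assumes "n \<ge> 2"
    and "0 \<le> v" and "v \<le> 1"
    and "linear_congestion_game G"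
    and "num_players G = n"
  shows "(v \<le> 1/2 \<longrightarrow>
            PoS_le G (uniform_context v)
              (ereal (((sqrt 3 + 1) * (1 - v)) / (sqrt 3 - v * (sqrt 3 - 1))))) \<and>
         (1/2 \<le> v \<longrightarrow>
            PoS_le G (uniform_context v)
              (if v = 1 then \<infinity>
               else ereal ((3 - sqrt 3 - 2 * v * (2 - sqrt 3)) / (2 * (1 - v)))))"
  using assms PoS_le_if_le_half[OF assms(4,2)] PoS_le_if_ge_half[OF assms(4)] PoS_le_infinity[OF assms(4)]
  by (cases "v = 1") simp_all

end
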